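(* Let $G\in\varepsilon_{03}$ and let $C,C'$ be two cycles of $G$ whose intersection is a path $P_t$ with $t>0$ edges. If both $C,C'$ are of type $0$, or one is of type $0$ and the other of type $3$, then $t$ is even. If both are of type $3$, then $t$ is odd.
   Context: All graphs are finite, simple and connected. An Euler graph is a connected graph all of whose nodes have even degree. A cycle of length $n$ is of type $i$ if $n\equiv i\pmod 4$. $\varepsilon_{03}$ is the class of Euler graphs in which every cycle has length $\equiv 0$ or $\equiv 3\pmod 4$ and which contain at least one cycle of each of the types $0$ and $3$. *)

theory Defs
  imports "Graph_Theory.Digraph_Component"
begin

text \<open>
  Finite simple graphs are the finite loop-free symmetric digraphs without parallel arcs of
  \<^locale>\<open>graph\<close>: an undirected edge \<open>{u, v}\<close> is a pair of opposite arcs, so the degree of a node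
  is its out-degree. In such a digraph the closed walk \<open>u, v, u\<close> is also a
  \<^const>\<open>pre_digraph.cycle\<close>; the length bound removes exactly these walks. A cycle is given by the
  list of its arcs, in one of its orientations and from one of its starting points, and its length
  is the length of the list.
\<close>

definition graph_cycle :: "('a, 'b) pre_digraph \<Rightarrow> 'b awalk \<Rightarrow> bool" where
  "graph_cycle G p \<longleftrightarrow> pre_digraph.cycle G p \<and> 3 \<le> length p"

definition cycle_of_type :: "('a, 'b) pre_digraph \<Rightarrow> nat \<Rightarrow> 'b awalk \<Rightarrow> bool" where
  "cycle_of_type G i p \<longleftrightarrow> graph_cycle G p \<and> length p mod 4 = i mod 4"

definition euler_graph :: "('a, 'b) pre_digraph \<Rightarrow> bool" where
  "euler_graph G \<longleftrightarrow> graph G \<and> connected G \<and> (\<forall>v \<in> verts G. even (out_degree G v))"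

definition eps03 :: "('a, 'b) pre_digraph set" where
  "eps03 = {G. euler_graph G
     \<and> (\<forall>p. graph_cycle G p \<longrightarrow> cycle_of_type G 0 p \<or> cycle_of_type G 3 p)
     \<and> (\<exists>p. cycle_of_type G 0 p) \<and> (\<exists>p. cycle_of_type G 3 p)}"

text \<open>
  The intersection of two cycles is the intersection of the corresponding subgraphs, nodes as well
  as edges. Edges are taken as unordered pairs, since the two cycles and the path may traverse a
  common edge in opposite directions.
\<close>

definition cycle_nodes :: "('a, 'b) pre_digraph \<Rightarrow> 'b awalk \<Rightarrow> 'a set" where
  "cycle_nodes G p = tail G ` set p \<union> head G ` set p"

definition walk_edges :: "('a, 'b) pre_digraph \<Rightarrow> 'b awalk \<Rightarrow> 'a set set" where
  "walk_edges G p = (\<lambda>e. {tail G e, head G e}) ` set p"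

definition cycles_meet_in_path ::
  "('a, 'b) pre_digraph \<Rightarrow> 'b awalk \<Rightarrow> 'b awalk \<Rightarrow> nat \<Rightarrow> bool" where
  "cycles_meet_in_path G C C' t \<longleftrightarrow>
     (\<exists>u P v. pre_digraph.apath G u P v \<and> length P = t
        \<and> cycle_nodes G C \<inter> cycle_nodes G C' = set (pre_digraph.awalk_verts G u P)
        \<and> walk_edges G C \<inter> walk_edges G C' = walk_edges G P)"

end

theory Submission
  imports Defs
begin

text \<open>
  Write \<open>C = P \<union> Q\<close> and \<open>C' = P \<union> Q'\<close>. The paths \<open>Q\<close> and \<open>Q'\<close> share only their end points, so
  \<open>Q \<union> Q'\<close> is again a cycle, of length \<open>|C| + |C'| - 2t\<close>. As this length is \<open>0\<close> or \<open>3\<close> modulo \<open>4\<close>,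
  the residues of \<open>|C|\<close> and \<open>|C'|\<close> determine the parity of \<open>t\<close>.
\<close>

text \<open>Rotating or reversing a cycle is only tracked through its edges; this carries conditions
  on nodes over to the rearranged cycle.\<close>

lemma cycle_nodes_eq_Union_walk_edges: "cycle_nodes G p = \<Union> (walk_edges G p)"
  by (auto simp: cycle_nodes_def walk_edges_def)

text \<open>Both sides are the node sequence of the walk. For a closed walk the heads are therefore
  a rearrangement of the tails, so that entering and leaving arcs can be treated alike.\<close>

lemma (in wf_digraph) awalk_heads_tails:
  assumes "awalk u p v"
  shows "u # map (head G) p = map (tail G) p @ [v]"
  using assms by (induction p arbitrary: u) (auto simp: awalk_simps)

lemma (in wf_digraph) closed_awalk_mset_heads:
  assumes "awalk u p u"
  shows "mset (map (head G) p) = mset (map (tail G) p)"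
proof -
  have "mset (u # map (head G) p) = mset (map (tail G) p @ [u])"
    using awalk_heads_tails[OF assms] by simp
  then show ?thesis by simp
qed

lemma (in wf_digraph) closed_awalk_distinct_heads:
  assumes "awalk u p u"
  shows "distinct (map (head G) p) \<longleftrightarrow> distinct (map (tail G) p)"
  using closed_awalk_mset_heads[OF assms] by (rule mset_eq_imp_distinct_iff)

text \<open>In \<open>awalk_verts\<close> the start of a closed walk occurs twice. The tails list
  each node of a cycle exactly once, which makes this form stable under rotation and
  reversal.\<close>

lemma (in wf_digraph) cycle_iff_distinct_tails:
  "cycle p \<longleftrightarrow> (\<exists>u. awalk u p u \<and> distinct (map (tail G) p) \<and> p \<noteq> [])"
proof -
  have "distinct (tl (awalk_verts u p)) \<longleftrightarrow> distinct (map (tail G) p)"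
    if "awalk u p u" "p \<noteq> []" for u
  proof -
    have "cas u p u" using that(1) by (simp add: awalk_def)
    then show ?thesis
      using that(2) closed_awalk_distinct_heads[OF that(1)] by (simp add: awalk_verts_conv')
  qed
  then show ?thesis unfolding cycle_def by blast
qed

lemma (in wf_digraph) cycle_rotate:
  assumes "cycle (p @ q)"
  shows "cycle (q @ p)"
proof -
  obtain u where u: "awalk u (p @ q) u" and d: "distinct (map (tail G) (p @ q))" "p @ q \<noteq> []"
    using assms unfolding cycle_iff_distinct_tails by blast
  have "awalk (awlast u p) (q @ p) (awlast u p)"
    using u by (auto intro: awalk_appendI)
  then show ?thesis using d unfolding cycle_iff_distinct_tails by (intro exI conjI) auto
qed

text \<open>Each arc is replaced by an opposite one, which symmetry provides. Recording the ordered
  pairs of ends keeps tails, heads, length and edges of the reversed walk all recoverable.\<close>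

lemma (in sym_digraph) awalk_reverse:
  assumes "awalk u p v"
  obtains q where "awalk v q u"
    "map (arc_to_ends G) q = rev (map (\<lambda>e. (head G e, tail G e)) p)"
  using assms
proof (induction p arbitrary: u thesis)
  case Nil
  then show ?case by (auto simp: awalk_simps)
next
  case (Cons e p)
  then have e: "e \<in> arcs G" "tail G e = u" and p: "awalk (head G e) p v"
    by (auto simp: awalk_simps)
  obtain q where q: "awalk v q (head G e)"
    "map (arc_to_ends G) q = rev (map (\<lambda>e. (head G e, tail G e)) p)"
    using Cons.IH p by blast
  obtain f where f: "f \<in> arcs G" "tail G f = head G e" "head G f = tail G e"
    using sym_arcs e(1) unfolding symmetric_conv by metis
  then have "awalk (head G e) [f] u" using e by (metis arc_implies_awalk)
  with q have "awalk v (q @ [f]) u" by (rule_tac awalk_appendI)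
  then show ?case
    by (rule Cons.prems(1)) (use q(2) f in \<open>simp add: arc_to_ends_def[of G f]\<close>)
qed

lemma tails_heads_of_reverse:
  assumes "map (arc_to_ends G) q = rev (map (\<lambda>e. (head G e, tail G e)) p)"
  shows "map (tail G) q = rev (map (head G) p)" "map (head G) q = rev (map (tail G) p)"
    "length q = length p" "walk_edges G q = walk_edges G p"
proof -
  show "map (tail G) q = rev (map (head G) p)"
    using arg_cong[OF assms, of "map fst"] by (simp add: arc_to_ends_def comp_def rev_map)
  show "map (head G) q = rev (map (tail G) p)"
    using arg_cong[OF assms, of "map snd"] by (simp add: arc_to_ends_def comp_def rev_map)
  show "length q = length p"
    using arg_cong[OF assms, of length] by simp
  \<comment> \<open>Forgetting the order within each pair of ends leaves the undirected
    edges.\<close>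
  have "(\<lambda>(x, y). {x, y}) ` arc_to_ends G ` set q
      = (\<lambda>(x, y). {x, y}) ` (\<lambda>e. (head G e, tail G e)) ` set p"
    using arg_cong[OF assms, of "\<lambda>l. (\<lambda>(x, y). {x, y}) ` set l"] by simp
  then show "walk_edges G q = walk_edges G p"
    by (simp add: walk_edges_def image_image arc_to_ends_def insert_commute)
qed

lemma (in sym_digraph) cycle_reverse:
  assumes "cycle p"
  obtains q where "cycle q" "map (arc_to_ends G) q = rev (map (\<lambda>e. (head G e, tail G e)) p)"
proof -
  obtain u where u: "awalk u p u" and d: "distinct (map (tail G) p)" "p \<noteq> []"
    using assms unfolding cycle_iff_distinct_tails by blast
  obtain q where q: "awalk u q u"
    "map (arc_to_ends G) q = rev (map (\<lambda>e. (head G e, tail G e)) p)"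
    using awalk_reverse[OF u] .
  have "distinct (map (tail G) q)"
    using d closed_awalk_distinct_heads[OF u] tails_heads_of_reverse(1)[OF q(2)] by simp
  moreover have "q \<noteq> []" using q(2) d(2) by auto
  ultimately have "cycle q" using q(1) unfolding cycle_iff_distinct_tails by blast
  then show ?thesis using q(2) that by blast
qed

text \<open>If the cycle runs through the edge against the direction of \<open>e\<close>, reverse it
  first; then rotate. Since there are no parallel arcs, the arc found with the ends of
  \<open>e\<close> is \<open>e\<close> itself.\<close>

lemma (in graph) cycle_starting_with_arc:
  assumes "cycle C" and e: "e \<in> arcs G" and "{tail G e, head G e} \<in> walk_edges G C"
  obtains R where "cycle (e # R)" "length (e # R) = length C"
    "walk_edges G (e # R) = walk_edges G C"
proof -
  note result = that
  have rot: thesis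
    if D: "cycle D" "length D = length C" "walk_edges G D = walk_edges G C"
      and f: "f \<in> set D" "tail G f = tail G e" "head G f = head G e" for D f
  proof -
    have "set D \<subseteq> arcs G" using D(1) by (auto simp: cycle_def awalk_def)
    then have "f = e" using f e by (intro no_multi_arcs) (auto simp: arc_to_ends_def)
    then obtain A B where AB: "D = A @ e # B" using f(1) by (auto simp: in_set_conv_decomp)
    have "cycle (e # (B @ A))" using cycle_rotate[of A "e # B"] D(1) AB by simp
    moreover have "length (e # (B @ A)) = length C" using AB D(2) by simp
    moreover have "walk_edges G (e # (B @ A)) = walk_edges G C"
      unfolding D(3)[symmetric] AB by (auto simp: walk_edges_def)
    ultimately show thesis by (rule result)
  qed
  obtain f where f: "f \<in> set C" "{tail G e, head G e} = {tail G f, head G f}"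
    using assms(3) by (auto simp: walk_edges_def)
  show thesis
  proof (cases "tail G f = tail G e")
    case True
    with f have "head G f = head G e" by (auto simp: doubleton_eq_iff)
    with True f(1) assms(1) show ?thesis using rot[of C f] by simp
  next
    case False
    then have ends: "tail G f = head G e" "head G f = tail G e"
      using f(2) by (auto simp: doubleton_eq_iff)
    obtain D where D: "cycle D"
      "map (arc_to_ends G) D = rev (map (\<lambda>e. (head G e, tail G e)) C)"
      using cycle_reverse[OF assms(1)] .
    have "(tail G e, head G e) \<in> set (map (arc_to_ends G) D)"
      unfolding D(2) using f(1) ends by force
    then obtain g where "g \<in> set D" "tail G g = tail G e" "head G g = head G e"
      by (auto simp: arc_to_ends_def)
    then show ?thesis
      using rot[of D g] D(1) tails_heads_of_reverse(3,4)[OF D(2)] by blast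
  qed
qed

lemma (in wf_digraph) apath_snoc_iff:
  "apath u (p @ [e]) v \<longleftrightarrow>
     apath u p (tail G e) \<and> e \<in> arcs G \<and> head G e = v \<and> v \<notin> set (awalk_verts u p)"
proof -
  have "awalk_verts u (p @ [e]) = awalk_verts u p @ [head G e]" if "awalk u p (tail G e)"
    using that by (induction p arbitrary: u) (auto simp: awalk_simps)
  moreover have "awalk u (p @ [e]) v \<longleftrightarrow> awalk u p (tail G e) \<and> e \<in> arcs G \<and> head G e = v"
    by (auto simp: awalk_simps)
  ultimately show ?thesis unfolding apath_def by auto
qed

text \<open>The first arc of \<open>P\<close> fixes orientation and starting point of the cycle.
  From then on the cycle has no choice: after an initial segment of \<open>P\<close> it must
  continue with the next arc of \<open>P\<close>.\<close>

lemma (in graph) cycle_starting_with_path: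
  assumes "cycle C" "apath u P v" "P \<noteq> []" "walk_edges G P \<subseteq> walk_edges G C"
  obtains R where "cycle (P @ R)" "length (P @ R) = length C"
    "walk_edges G (P @ R) = walk_edges G C"
  using assms(3,2,4)
proof (induction P arbitrary: v thesis rule: rev_nonempty_induct)
  case (single e)
  then show ?case
    using cycle_starting_with_arc[OF assms(1), of e]
    by (auto simp: apath_simps walk_edges_def)
next
  case (snoc e P)
  let ?w = "tail G e"
  have P: "apath u P ?w" and e: "e \<in> arcs G" "head G e = v" "v \<notin> set (awalk_verts u P)"
    using snoc.prems(2) by (auto simp: apath_snoc_iff)
  have "walk_edges G P \<subseteq> walk_edges G C" "{?w, v} \<in> walk_edges G C"
    using snoc.prems(3) e by (auto simp: walk_edges_def)
  then obtain R where R: "cycle (P @ R)" "length (P @ R) = length C"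
    "walk_edges G (P @ R) = walk_edges G C"
    using snoc.IH[OF _ P] by metis
  obtain x where x: "awalk x (P @ R) x" "distinct (map (tail G) (P @ R))"
    using R(1) unfolding cycle_iff_distinct_tails by blast
  \<comment> \<open>A nonempty walk determines its ends, so the closed walk \<open>P @ R\<close>
    starts at \<open>u\<close>.\<close>
  have walks: "awalk u P ?w" "awalk ?w R u"
  proof -
    have "awalk u P ?w" using P by (simp add: apath_def)
    moreover have "awalk x P (awlast x P)" "awalk (awlast x P) R x" using x(1) by auto
    ultimately show "awalk u P ?w" "awalk ?w R u"
      using awalk_ends[of x P "awlast x P" u ?w] snoc.hyps by auto
  qed
  have "u \<noteq> ?w" using apath_nonempty_ends[OF P] snoc.hyps by blast
  then obtain g R' where g: "R = g # R'" using walks(2) by (cases R) (auto simp: awalk_simps)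
  then have gt: "tail G g = ?w" "g \<in> arcs G" using walks(2) by (auto simp: awalk_simps)
  obtain f where f: "f \<in> set (P @ R)" "{?w, v} = {tail G f, head G f}"
    using \<open>{?w, v} \<in> walk_edges G C\<close> unfolding R(3)[symmetric] by (auto simp: walk_edges_def)
  \<comment> \<open>Otherwise \<open>f\<close> leads from \<open>v\<close> to \<open>?w\<close>. The
    last arc of \<open>P\<close> already enters \<open>?w\<close>, and only one arc of the cycle
    does, so \<open>f\<close> lies in \<open>P\<close> and \<open>v\<close> is a node of
    \<open>P\<close>, contrary to \<open>P @ [e]\<close> being a path.\<close>
  have "tail G f = ?w"
  proof (rule ccontr)
    assume "tail G f \<noteq> ?w"
    then have ft: "tail G f = v" "head G f = ?w" using f(2) by (auto simp: doubleton_eq_iff)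
    have hd: "distinct (map (head G) (P @ R))"
      using closed_awalk_distinct_heads[OF x(1)] x(2) by simp
    have "last (u # map (head G) P) = ?w"
      unfolding awalk_heads_tails[OF walks(1)] by simp
    then have "?w \<in> head G ` set P"
      using snoc.hyps by (metis image_eqI last_ConsR last_in_set last_map list.map_disc_iff)
    then have "f \<in> set P" using ft(2) f(1) hd by auto (metis IntI empty_iff image_eqI)
    then show False using e(3) ft(1) awalk_verts_arc1 by metis
  qed
  moreover have "g \<in> set (P @ R)" using g by simp
  ultimately have "f = g" using f(1) gt(1) x(2) unfolding distinct_map inj_on_def by metis
  then have "head G g = v" using f(2) gt(1) by (auto simp: doubleton_eq_iff)
  then have "g = e" using gt e by (intro no_multi_arcs) (auto simp: arc_to_ends_def)
  then show ?case using snoc.prems(1)[of R'] R g by simp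
qed

lemma (in graph) symmetric_difference_of_cycles:
  assumes PQ: "graph_cycle G (P @ Q)" and PQ': "graph_cycle G (P @ Q')"
    and P: "apath u P v" "P \<noteq> []"
    and nodes: "cycle_nodes G (P @ Q) \<inter> cycle_nodes G (P @ Q') = set (awalk_verts u P)"
    and edges: "walk_edges G (P @ Q) \<inter> walk_edges G (P @ Q') = walk_edges G P"
  obtains D where "graph_cycle G D" "length D = length Q + length Q'"
proof -
  have uv: "u \<noteq> v" using apath_nonempty_ends P by blast
  have Pw: "awalk u P v" using P by (simp add: apath_def)
  have split: "awalk v R u \<and> R \<noteq> [] \<and> distinct (map (tail G) (P @ R))
      \<and> distinct (map (head G) (P @ R))" if PR: "graph_cycle G (P @ R)" for R
  proof -
    obtain x where x: "awalk x (P @ R) x" "distinct (map (tail G) (P @ R))"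
      using PR unfolding graph_cycle_def cycle_iff_distinct_tails by blast
    then have "awalk x P (awlast x P)" "awalk (awlast x P) R x" by auto
    then have R: "awalk v R u"
      using awalk_ends[of x P "awlast x P" u v] Pw P(2) by auto
    with uv have "R \<noteq> []" by (auto simp: awalk_simps)
    with R x closed_awalk_distinct_heads[OF x(1)] show ?thesis by simp
  qed
  note Q = split[OF PQ] and Q' = split[OF PQ']
  obtain S where S: "awalk u S v"
    "map (arc_to_ends G) S = rev (map (\<lambda>e. (head G e, tail G e)) Q')"
    using awalk_reverse Q' by blast
  \<comment> \<open>The tails of \<open>Q\<close> omit its end \<open>u\<close>, and the heads of
    \<open>Q'\<close> omit its start \<open>v\<close>, so the shared end points do no harm. Any
    other common node would lie on \<open>P\<close>, hence be left or entered by an arc of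
    \<open>P\<close>, and so be left twice in \<open>P @ Q\<close> or entered twice in
    \<open>P @ Q'\<close>.\<close>
  have "tail G ` set Q \<inter> head G ` set Q' = {}"
  proof (rule ccontr)
    assume "\<not> ?thesis"
    then obtain x where x: "x \<in> tail G ` set Q" "x \<in> head G ` set Q'" by blast
    then have "x \<in> set (awalk_verts u P)"
      using nodes by (auto simp: cycle_nodes_def)
    moreover have "x \<notin> tail G ` set P" "x \<notin> head G ` set P"
      using x Q Q' by auto
    ultimately show False using P(2) Pw by (simp add: set_awalk_verts_not_Nil)
  qed
  then have "distinct (map (tail G) (Q @ S))"
    using Q Q' arg_cong[OF tails_heads_of_reverse(1)[OF S(2)], of set]
    by (auto simp: tails_heads_of_reverse(1)[OF S(2)] simp flip: set_map)
  moreover have "awalk v (Q @ S) v" using Q S by (auto intro: awalk_appendI)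
  ultimately have "cycle (Q @ S)"
    unfolding cycle_iff_distinct_tails using Q by blast
  moreover have len: "length S = length Q'" using tails_heads_of_reverse(3)[OF S(2)] .
  \<comment> \<open>If \<open>Q\<close> and \<open>Q'\<close> were single arcs, their common edge
    would belong to \<open>P\<close>. Its arc \<open>g\<close> in \<open>P\<close> cannot leave
    \<open>v\<close>, as \<open>e\<close> does, so it goes from \<open>u\<close> to \<open>v\<close>
    and is both the first and the last arc of \<open>P\<close>; but \<open>P\<close> has at least
    two arcs.\<close>
  moreover have "3 \<le> length (Q @ S)"
  proof (rule ccontr)
    assume "\<not> ?thesis"
    moreover have "length Q \<ge> 1" "length Q' \<ge> 1" using Q Q' by (simp_all add: Suc_le_eq)
    ultimately have "length Q = 1" "length Q' = 1" using len by simp_all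
    then obtain e f where ef: "Q = [e]" "Q' = [f]" by (auto simp: length_Suc_conv)
    then have ends: "tail G e = v" "head G e = u" "tail G f = v" "head G f = u"
      using Q Q' by (auto simp: awalk_simps)
    then have "{v, u} \<in> walk_edges G P"
      using ef unfolding edges[symmetric] by (auto simp: walk_edges_def)
    then obtain g where g: "g \<in> set P" "{v, u} = {tail G g, head G g}"
      by (auto simp: walk_edges_def)
    moreover have "tail G g \<noteq> v" using Q ef ends g(1) by (force simp: image_iff)
    ultimately have gu: "tail G g = u" "head G g = v" by (auto simp: doubleton_eq_iff)
    have "2 \<le> length P" using PQ ef by (simp add: graph_cycle_def)
    then obtain h P' k where P': "P = h # P' @ [k]"
      by (cases P; cases "tl P" rule: rev_cases) auto
    have hk: "tail G h = u" "head G k = v"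
      using Pw awalk_heads_tails[OF Pw] P' by (auto simp: awalk_simps)
    have "g = h" using g(1) gu(1) hk(1) P' Q by force
    moreover have "g = k" using g(1) gu(2) hk(2) P' Q by force
    ultimately show False using P' Q by simp
  qed
  ultimately show thesis using that[of "Q @ S"] by (simp add: graph_cycle_def)
qed

text \<open>Modulo 4 only the parity of \<open>t\<close> matters. For even \<open>t\<close>,
  \<open>a + b\<close> is congruent to 0 or 3, which excludes 3 + 3. For odd \<open>t\<close> it is
  congruent to 2 or 1, and of these only 2 is attainable, as 3 + 3.\<close>

lemma odd_iff_both_type_3:
  fixes a b d t :: nat
  assumes "a + b = d + 2 * t" "a mod 4 \<in> {0, 3}" "b mod 4 \<in> {0, 3}" "d mod 4 \<in> {0, 3}"
  shows "odd t \<longleftrightarrow> a mod 4 = 3 \<and> b mod 4 = 3"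
proof -
  have "(a mod 4 + b mod 4) mod 4 = (d mod 4 + 2 * (t mod 2)) mod 4"
    using arg_cong[OF assms(1), of "\<lambda>n. n mod 4"] mult_mod_right[of 2 t 2]
    by (simp add: mod_simps)
  then show ?thesis
    using assms(2-)
    by (cases "even t") (auto simp: odd_iff_mod_2_eq_one even_iff_mod_2_eq_zero)
qed

theorem theorem10:
  fixes G :: "('a, 'b) pre_digraph" and C C' :: "'b awalk" and t :: nat
  assumes "G \<in> eps03"
    and "graph_cycle G C" and "graph_cycle G C'"
    and "cycles_meet_in_path G C C' t" and "0 < t"
  shows "((cycle_of_type G 0 C \<and> cycle_of_type G 0 C')
            \<or> (cycle_of_type G 0 C \<and> cycle_of_type G 3 C')
            \<or> (cycle_of_type G 3 C \<and> cycle_of_type G 0 C') \<longrightarrow> even t)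
       \<and> (cycle_of_type G 3 C \<and> cycle_of_type G 3 C' \<longrightarrow> odd t)"
proof -
  interpret graph G using assms(1) by (simp add: eps03_def euler_graph_def)
  obtain u P v where P: "apath u P v" "length P = t"
    and nodes: "cycle_nodes G C \<inter> cycle_nodes G C' = set (awalk_verts u P)"
    and edges: "walk_edges G C \<inter> walk_edges G C' = walk_edges G P"
    using assms(4) unfolding cycles_meet_in_path_def by blast
  have ne: "P \<noteq> []" using P(2) assms(5) by auto
  obtain Q where Q: "cycle (P @ Q)" "length (P @ Q) = length C"
    "walk_edges G (P @ Q) = walk_edges G C"
    using cycle_starting_with_path[OF _ P(1) ne, of C] assms(2) edges
    unfolding graph_cycle_def by blast
  obtain Q' where Q': "cycle (P @ Q')" "length (P @ Q') = length C'"
    "walk_edges G (P @ Q') = walk_edges G C'"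
    using cycle_starting_with_path[OF _ P(1) ne, of C'] assms(3) edges
    unfolding graph_cycle_def by blast
  have "graph_cycle G (P @ Q)" "graph_cycle G (P @ Q')"
    using Q Q' assms(2,3) unfolding graph_cycle_def by simp_all
  then obtain D where D: "graph_cycle G D" "length D = length Q + length Q'"
    using symmetric_difference_of_cycles[OF _ _ P(1) ne] nodes edges Q(3) Q'(3)
    unfolding cycle_nodes_eq_Union_walk_edges by metis
  have "length X mod 4 \<in> {0, 3}" if "graph_cycle G X" for X
    using assms(1) that by (auto simp: eps03_def cycle_of_type_def)
  moreover have "length C + length C' = length D + 2 * t"
    using Q(2) Q'(2) P(2) D(2) by simp
  ultimately have "odd t \<longleftrightarrow> length C mod 4 = 3 \<and> length C' mod 4 = 3"
    using odd_iff_both_type_3 assms(2,3) D(1) by blast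
  then show ?thesis by (auto simp: cycle_of_type_def)
qed

end
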